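(* Let $X,Y$ be LCTV spaces, $\phi\colon X\times Y\to\overline{\mathbb R}$ a function, $F\colon X\rightrightarrows Y$ a set-valued mapping, and let $\mu(x):=\inf\{\phi(x,y)\mid y\in F(x)\}$ for $x\in X$. Suppose that $\mu(0)\in\mathbb R$ and that the set $F(0)$ is compact. Suppose further that $F$ is convex and upper semicontinuous at $0$ and that $\phi$ is convex and lower semicontinuous at $(0,y)$ for all $y\in F(0)$. Then $$\sup\{-\mu^*(x^* )\mid x^*\in X^*\}=\inf\{\phi(0,y)\mid y\in F(0)\}\in\mathbb R.$$
   Context: LCTV space means real locally convex Hausdorff topological vector space; $X^*$ is the topological dual and $\langle x^*,x\rangle=x^*(x)$. $\overline{\mathbb R}=\mathbb R\cup\{-\infty\}\cup\{\infty\}$ and $\inf\emptyset=\infty$. A function is convex if its epigraph $\{(x,\lambda)\mid f(x)\le\lambda\}$ (with $\lambda\in\mathbb R$) is convex; $F$ is convex if its graph $\{(x,y)\mid y\in F(x)\}$ is convex. $f$ is lower semicontinuous at $x_0$ if for each real $\lambda<f(x_0)$ there is a neighborhood $V$ of $x_0$ with $\lambda<f(x)$ for all $x\in V$. $F$ is upper semicontinuous at $x_0$ (with $F(x_0)\neq\emptyset$) if for any open $V\supset F(x_0)$ there is a neighborhood $U$ of $x_0$ with $F(x)\subset V$ for all $x\in U$. $\mu^*(x^* )=\sup\{\langle x^*,x\rangle-\mu(x)\mid x\in X\}$. *)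

theory Defs
  imports "HOL-Analysis.Analysis"
begin

(* Local convexity unfolds the library's convex, which is not available inside a class
   specification; lctv_convex_nhds_0 below restates it with convex.  Continuity of negation,
   which topological_ab_group_add also requires, is no additional restriction: it follows from
   joint continuity of scalar multiplication. *)
class lctv_space = real_vector + t2_space + topological_ab_group_add +
  assumes tendsto_scaleR_nhds:
      "filterlim (\<lambda>(r, x). r *\<^sub>R x) (nhds (s *\<^sub>R a)) (nhds s \<times>\<^sub>F nhds a)"
    and ex_convex_nhd_0:
      "open U \<Longrightarrow> 0 \<in> U \<Longrightarrow>
        \<exists>V. (\<forall>x\<in>V. \<forall>y\<in>V. \<forall>u\<ge>0. \<forall>v\<ge>0. u + v = 1 \<longrightarrow> u *\<^sub>R x + v *\<^sub>R y \<in> V)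
          \<and> (\<exists>W. open W \<and> 0 \<in> W \<and> W \<subseteq> V) \<and> V \<subseteq> U"

lemma lctv_continuous_scaleR:
  "continuous_on UNIV (\<lambda>(r, x::'a::lctv_space). r *\<^sub>R x)"
proof -
  have "((\<lambda>(r, x). r *\<^sub>R x) \<longlongrightarrow> s *\<^sub>R a) (at (s, a))" for s and a :: 'a
    by (rule tendsto_mono[OF _ tendsto_scaleR_nhds]) (simp add: at_within_def nhds_prod)
  then show ?thesis
    by (auto simp: continuous_on_def)
qed

lemma lctv_convex_nhds_0:
  fixes U :: "'a::lctv_space set"
  assumes "open U" "0 \<in> U"
  shows "\<exists>V. convex V \<and> 0 \<in> interior V \<and> V \<subseteq> U"
proof -
  obtain V W where V: "\<forall>x\<in>V. \<forall>y\<in>V. \<forall>u\<ge>0. \<forall>v\<ge>0. u + v = 1 \<longrightarrow> u *\<^sub>R x + v *\<^sub>R y \<in> V"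
    and W: "open W" "0 \<in> W" "W \<subseteq> V" and "V \<subseteq> U"
    using ex_convex_nhd_0[OF assms] by auto
  moreover from V have "convex V"
    by (simp only: convex_def)
  moreover from W have "0 \<in> interior V"
    by (rule interiorI)
  ultimately show ?thesis
    by metis
qed

instance real_normed_vector \<subseteq> lctv_space
proof
  fix s :: real and a :: 'a
  show "filterlim (\<lambda>(r, x). r *\<^sub>R x) (nhds (s *\<^sub>R a)) (nhds s \<times>\<^sub>F nhds a)"
    unfolding case_prod_beta by (intro tendsto_scaleR filterlim_fst filterlim_snd)
next
  fix U :: "'a set"
  assume "open U" "0 \<in> U"
  then obtain e where "e > 0" "ball 0 e \<subseteq> U"
    by (auto simp: open_contains_ball)
  moreover have "\<forall>x\<in>ball (0::'a) e. \<forall>y\<in>ball 0 e. \<forall>u\<ge>0. \<forall>v\<ge>0.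
      u + v = 1 \<longrightarrow> u *\<^sub>R x + v *\<^sub>R y \<in> ball 0 e"
    using convex_ball[of "0::'a" e] by (simp only: convex_def)
  ultimately show "\<exists>V. (\<forall>x\<in>V. \<forall>y\<in>V. \<forall>u\<ge>0. \<forall>v\<ge>0. u + v = 1 \<longrightarrow> u *\<^sub>R x + v *\<^sub>R y \<in> V)
      \<and> (\<exists>W. open W \<and> 0 \<in> W \<and> W \<subseteq> V) \<and> V \<subseteq> U"
    by (metis centre_in_ball open_ball order_refl)
qed

definition topological_dual :: "('a::lctv_space \<Rightarrow> real) set" where
  "topological_dual = {f. linear f \<and> continuous_on UNIV f}"

(* Convexity of extended-real-valued functions is stated through the epigraph, whose second
   component is real; this avoids sums of the form infinity - infinity. *)
definition epi :: "('a \<Rightarrow> ereal) \<Rightarrow> ('a \<times> real) set" where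
  "epi f = {(x, l). f x \<le> ereal l}"

definition convex_fun :: "('a::real_vector \<Rightarrow> ereal) \<Rightarrow> bool" where
  "convex_fun f \<longleftrightarrow> convex (epi f)"

definition graph :: "('a \<Rightarrow> 'b set) \<Rightarrow> ('a \<times> 'b) set" where
  "graph F = {(x, y). y \<in> F x}"

definition convex_map :: "('a::real_vector \<Rightarrow> 'b::real_vector set) \<Rightarrow> bool" where
  "convex_map F \<longleftrightarrow> convex (graph F)"

definition lsc_at :: "('a::topological_space \<Rightarrow> ereal) \<Rightarrow> 'a \<Rightarrow> bool" where
  "lsc_at f x0 \<longleftrightarrow> (\<forall>l::real. ereal l < f x0 \<longrightarrow>
     (\<exists>V. x0 \<in> interior V \<and> (\<forall>x\<in>V. ereal l < f x)))"

definition usc_map_at ::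
    "('a::topological_space \<Rightarrow> 'b::topological_space set) \<Rightarrow> 'a \<Rightarrow> bool" where
  "usc_map_at F x0 \<longleftrightarrow> F x0 \<noteq> {} \<and> (\<forall>V. open V \<longrightarrow> F x0 \<subseteq> V \<longrightarrow>
     (\<exists>U. x0 \<in> interior U \<and> (\<forall>x\<in>U. F x \<subseteq> V)))"

definition marginal :: "('a \<times> 'b \<Rightarrow> ereal) \<Rightarrow> ('a \<Rightarrow> 'b set) \<Rightarrow> 'a \<Rightarrow> ereal" where
  "marginal \<phi> F x = (INF y\<in>F x. \<phi> (x, y))"

(* The first summand is real, so the subtraction in ereal is never indeterminate. *)
definition fenchel_conjugate :: "('a \<Rightarrow> ereal) \<Rightarrow> ('a \<Rightarrow> real) \<Rightarrow> ereal" where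
  "fenchel_conjugate f xs = (SUP x. ereal (xs x) - f x)"

end

theory Submission
  imports Defs
begin

text \<open>
  The theorem says that the primal value \<open>\<mu> 0\<close> of a convex program equals its dual value, and the
  reason is the usual one: the marginal function \<open>\<mu>\<close> is convex and lower semicontinuous at \<open>0\<close>, so
  every real number \<open>\<beta>\<close> below \<open>\<mu> 0\<close> is the value at \<open>0\<close> of a continuous affine minorant
  \<open>x \<mapsto> g x + \<beta>\<close> of \<open>\<mu>\<close>.  For such a \<open>g\<close> the conjugate of \<open>\<mu>\<close> is at most \<open>- \<beta>\<close>, while weak duality
  bounds the dual value by \<open>\<mu> 0\<close>.

  Lower semicontinuity (\<open>marginal_ge_on_neighbourhood\<close>) is a tube-lemma argument: by compactness,
  finitely many open boxes on which \<open>\<phi> > \<beta>\<close> cover \<open>{0} \<times> F 0\<close>, and upper semicontinuity keeps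
  \<open>F x\<close> inside the resulting open set for \<open>x\<close> near \<open>0\<close>.

  The affine minorant (\<open>continuous_affine_minorant\<close>) comes from the Hahn-Banach theorem, used in the
  following geometric form.  If a convex cone in \<open>X \<times> \<real>\<close> projects onto \<open>X\<close> and meets the axis
  \<open>{0} \<times> \<real>\<close> only in its nonnegative half, then the cone lies above the graph of a linear functional
  (\<open>linear_functional_below_convex_cone\<close>).  The cone to which this is applied is generated by two
  sets at once: the epigraph translated down by \<open>\<beta>\<close>, which makes the functional a minorant, and
  \<open>V \<times> {c}\<close> for a neighbourhood \<open>V\<close> of \<open>0\<close> on which \<open>\<mu> \<ge> \<beta>\<close>, which makes the cone project onto
  \<open>X\<close> and bounds the functional by \<open>c\<close> on \<open>V\<close>, so that it is continuous.  The second set is needed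
  because the effective domain of \<open>\<mu>\<close> need not be a neighbourhood of \<open>0\<close>.
\<close>

section \<open>Linear functionals below convex cones\<close>

text \<open>
  Cones that meet the vertical axis only in its nonnegative half are closed under unions of chains,
  so Zorn's lemma applies.
\<close>

lemma ex_maximal_cone_above_origin:
  fixes K :: "('a::real_vector \<times> real) set"
  assumes "convex_cone K" and "\<And>t. (0, t) \<in> K \<Longrightarrow> 0 \<le> t"
  obtains M where "K \<subseteq> M" "convex_cone M" "\<And>t. (0, t) \<in> M \<Longrightarrow> 0 \<le> t"
    and "\<And>N. \<lbrakk>M \<subseteq> N; convex_cone N; \<And>t. (0, t) \<in> N \<Longrightarrow> 0 \<le> t\<rbrakk> \<Longrightarrow> N = M"
proof -
  define \<A> where "\<A> = {N. K \<subseteq> N \<and> convex_cone N \<and> (\<forall>t. (0, t) \<in> N \<longrightarrow> 0 \<le> t)}"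
  have "\<exists>M\<in>\<A>. \<forall>N\<in>\<A>. M \<subseteq> N \<longrightarrow> N = M"
  proof (rule subset_Zorn_nonempty)
    show "\<A> \<noteq> {}"
      using assms by (auto simp: \<A>_def)
  next
    fix \<C> assume "\<C> \<noteq> {}" and chain: "subset.chain \<A> \<C>"
    then obtain N0 where N0: "N0 \<in> \<C>"
      by blast
    have \<C>: "K \<subseteq> N" "convex_cone N" "\<forall>t. (0, t) \<in> N \<longrightarrow> 0 \<le> t" if "N \<in> \<C>" for N
    proof -
      have "N \<in> \<A>"
        using chain that by (auto simp: subset_chain_def)
      then show "K \<subseteq> N" "convex_cone N" "\<forall>t. (0, t) \<in> N \<longrightarrow> 0 \<le> t"
        by (simp_all add: \<A>_def)
    qed
    have "convex_cone (\<Union>\<C>)"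
      unfolding convex_cone_iff
    proof (intro conjI ballI allI impI)
      show "0 \<in> \<Union>\<C>"
        using N0 \<C>(2) convex_cone_contains_0 by blast
    next
      fix x y assume "x \<in> \<Union>\<C>" "y \<in> \<Union>\<C>"
      then obtain N where "N \<in> \<C>" "x \<in> N" "y \<in> N"
        using chain by (auto simp: subset_chain_def) blast
      then show "x + y \<in> \<Union>\<C>"
        using \<C>(2) convex_cone_add by blast
    next
      fix x and r :: real assume "x \<in> \<Union>\<C>" "0 \<le> r"
      then show "r *\<^sub>R x \<in> \<Union>\<C>"
        using \<C>(2) convex_cone_scaleR by blast
    qed
    then show "\<Union>\<C> \<in> \<A>"
      using N0 \<C> unfolding \<A>_def by blast
  qed
  then obtain M where M: "M \<in> \<A>" and max: "\<And>N. \<lbrakk>N \<in> \<A>; M \<subseteq> N\<rbrakk> \<Longrightarrow> N = M"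
    by blast
  show ?thesis
  proof (rule that)
    show "K \<subseteq> M" "convex_cone M" "\<And>t. (0, t) \<in> M \<Longrightarrow> 0 \<le> t"
      using M by (simp_all add: \<A>_def)
    show "N = M" if "M \<subseteq> N" "convex_cone N" "\<And>t. (0, t) \<in> N \<Longrightarrow> 0 \<le> t" for N
      using max[of N] that \<open>K \<subseteq> M\<close> by (auto simp: \<A>_def)
  qed
qed

text \<open>
  This is the Hahn-Banach theorem in the form of M. Riesz.  Take a maximal cone \<open>M\<close> and let \<open>\<alpha>\<close> be
  the height at which \<open>M\<close> begins above \<open>x\<close>.  The ray through \<open>- (x, \<alpha>)\<close> can be added to \<open>M\<close> without
  reaching below the origin, so by maximality it is already in \<open>M\<close>.  Hence the largest linear
  subspace of \<open>M\<close> projects onto the whole space; since it contains no nonzero vertical vector, it is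
  the graph of a linear functional.
\<close>

lemma linear_functional_below_convex_cone:
  fixes K :: "('a::real_vector \<times> real) set"
  assumes "convex_cone K" and "\<And>t. (0, t) \<in> K \<Longrightarrow> 0 \<le> t" and "\<And>x. \<exists>t. (x, t) \<in> K"
  obtains g where "linear g" "\<And>x t. (x, t) \<in> K \<Longrightarrow> g x \<le> t"
proof -
  obtain M where "K \<subseteq> M" and cone: "convex_cone M" and pos: "\<And>t. (0, t) \<in> M \<Longrightarrow> 0 \<le> t"
    and max: "\<And>N. \<lbrakk>M \<subseteq> N; convex_cone N; \<And>t. (0, t) \<in> N \<Longrightarrow> 0 \<le> t\<rbrakk> \<Longrightarrow> N = M"
    using ex_maximal_cone_above_origin[OF assms(1,2)] by blast
  have onto: "\<exists>t. (x, t) \<in> M" for x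
    using assms(3) \<open>K \<subseteq> M\<close> by blast
  have add: "(x + y, s + t) \<in> M" if "(x, s) \<in> M" "(y, t) \<in> M" for x y s t
    using convex_cone_add[OF cone that] by simp
  have scale: "(r *\<^sub>R x, r * t) \<in> M" if "(x, t) \<in> M" "0 \<le> r" for r x t
    using convex_cone_scaleR[OF cone that(2,1)] by simp

  have neg_le: "- s \<le> t" if "(- x, s) \<in> M" "(x, t) \<in> M" for x s t
    using add[OF that] pos[of "s + t"] by simp

  define low where "low x = Inf {t. (x, t) \<in> M}" for x
  have le_low: "s \<le> low x" if "\<And>t. (x, t) \<in> M \<Longrightarrow> s \<le> t" for x s
    unfolding low_def using onto[of x] that by (intro cInf_greatest) auto
  have low_le: "low x \<le> t" if "(x, t) \<in> M" for x t
  proof -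
    obtain s where s: "(- x, s) \<in> M"
      using onto by blast
    have "bdd_below {t. (x, t) \<in> M}"
      unfolding bdd_below_def using neg_le[OF s] by blast
    then show ?thesis
      using that by (auto simp: low_def intro: cInf_lower)
  qed
  have opposite: "(- x, - low x) \<in> M" for x
  proof -
    let ?N = "convex_cone hull (M \<union> {(- x, - low x)})"
    have "?N = M"
    proof (rule max)
      show "M \<subseteq> ?N"
        by (auto intro: hull_inc)
      show "convex_cone ?N"
        by (rule convex_cone_convex_cone_hull)
    next
      fix t assume "(0, t) \<in> ?N"
      then obtain p q where p: "p \<in> convex_cone hull M" and q: "q \<in> convex_cone hull {(- x, - low x)}"
        and "(0, t) = p + q"
        unfolding convex_cone_hull_Un by blast
      from p have "p \<in> M"
        using cone by (simp add: hull_same)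
      from q obtain r where "0 \<le> r" and "q = r *\<^sub>R (- x, - low x)"
        by (auto simp: convex_cone_hull_convex_hull_nonempty)
      have "p = (0, t) - q"
        using \<open>(0, t) = p + q\<close> by simp
      then have "p = (r *\<^sub>R x, t + r * low x)"
        using \<open>q = _\<close> by simp
      with \<open>p \<in> M\<close> have M: "(r *\<^sub>R x, t + r * low x) \<in> M"
        by simp
      show "0 \<le> t"
      proof (cases "r = 0")
        case True
        then show ?thesis
          using M pos by simp
      next
        case False
        with \<open>0 \<le> r\<close> have "0 < r"
          by simp
        then have "(x, (t + r * low x) / r) \<in> M"
          using scale[OF M, of "1 / r"] by simp
        from low_le[OF this] have "low x * r \<le> t + r * low x"
          using \<open>0 < r\<close> by (simp add: pos_le_divide_eq)
        then show ?thesis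
          by (simp add: mult.commute)
      qed
    qed
    moreover have "(- x, - low x) \<in> ?N"
      by (auto intro: hull_inc)
    ultimately show ?thesis
      by simp
  qed
  have low_uminus: "low (- x) = - low x" for x
  proof (rule antisym)
    show "low (- x) \<le> - low x"
      by (rule low_le[OF opposite])
    show "- low x \<le> low (- x)"
    proof (rule le_low)
      fix s assume "(- x, s) \<in> M"
      then have "- s \<le> low x"
        using neg_le le_low by blast
      then show "- low x \<le> s"
        by simp
    qed
  qed
  have graph: "(x, low x) \<in> M" for x
    using opposite[of "- x"] low_uminus by simp
  have subadd: "low (x + y) \<le> low x + low y" for x y
    by (rule low_le[OF add[OF graph graph]])
  have superscale: "low (r *\<^sub>R x) \<le> r * low x" if "0 \<le> r" for r x
    by (rule low_le[OF scale[OF graph that]])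
  have "linear low"
  proof (rule linearI)
    fix x y
    show "low (x + y) = low x + low y"
      using subadd[of x y] subadd[of "- x" "- y"] low_uminus[of "x + y"] low_uminus[of x]
        low_uminus[of y] by simp
  next
    have nonneg: "low (r *\<^sub>R x) = r * low x" if "0 \<le> r" for r x
      using superscale[OF that, of x] superscale[OF that, of "- x"] low_uminus[of "r *\<^sub>R x"]
        low_uminus[of x] by simp
    fix r x
    show "low (r *\<^sub>R x) = r *\<^sub>R low x"
      using nonneg[of r x] nonneg[of "- r" x] low_uminus[of "r *\<^sub>R x"] by (cases "0 \<le> r") auto
  qed
  then show ?thesis
    using that low_le \<open>K \<subseteq> M\<close> by blast
qed

section \<open>Continuity in topological vector spaces\<close>

lemma tendsto_scaleR_diff_0:
  fixes x :: "'a::lctv_space"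
  shows "((\<lambda>y. k *\<^sub>R (y - x)) \<longlongrightarrow> 0) (nhds x)"
proof -
  have "((\<lambda>y. y - x) \<longlongrightarrow> x - x) (nhds x)"
    by (intro tendsto_diff tendsto_const) (simp add: filterlim_ident)
  then have "filterlim (\<lambda>y. (k, y - x)) (nhds k \<times>\<^sub>F nhds 0) (nhds x)"
    by (intro filterlim_Pair tendsto_const) simp
  from filterlim_compose[OF tendsto_scaleR_nhds[of k "0::'a"] this] show ?thesis
    by simp
qed

lemma tendsto_scaleR_0:
  fixes x :: "'a::lctv_space"
  shows "((\<lambda>r. r *\<^sub>R x) \<longlongrightarrow> 0) (nhds 0)"
proof -
  have "filterlim (\<lambda>r. (r, x)) (nhds 0 \<times>\<^sub>F nhds x) (nhds (0::real))"
    by (intro filterlim_Pair tendsto_const) (simp add: filterlim_ident)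
  from filterlim_compose[OF tendsto_scaleR_nhds[of 0 x] this] show ?thesis
    by simp
qed

lemma neighbourhood_of_0_absorbing:
  fixes x :: "'a::lctv_space"
  assumes "0 \<in> interior V"
  obtains r where "0 < r" "r *\<^sub>R x \<in> V"
proof -
  have "\<forall>\<^sub>F r in nhds 0. r *\<^sub>R x \<in> interior V"
    using topological_tendstoD[OF tendsto_scaleR_0] assms by blast
  then obtain d where "0 < d" "\<And>r. dist r 0 < d \<Longrightarrow> r *\<^sub>R x \<in> interior V"
    unfolding eventually_nhds_metric by blast
  then have "(d / 2) *\<^sub>R x \<in> V"
    using interior_subset by fastforce
  with \<open>0 < d\<close> that[of "d / 2"] show ?thesis
    by simp
qed

lemma continuous_on_linear_if_bounded_on_neighbourhood:
  fixes g :: "'a::lctv_space \<Rightarrow> real"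
  assumes "linear g" "0 \<in> interior V" and bound: "\<And>v. v \<in> V \<Longrightarrow> \<bar>g v\<bar> \<le> c"
  shows "continuous_on UNIV g"
proof -
  have "(g \<longlongrightarrow> g x) (nhds x)" for x
  proof (rule tendstoI)
    fix e :: real assume "0 < e"
    have "0 \<le> c"
      using bound[of 0] assms(2) interior_subset by fastforce
    define k where "k = (c + 1) / e"
    have "0 < k" "c < k * e"
      using \<open>0 < e\<close> \<open>0 \<le> c\<close> by (simp_all add: k_def)
    have "\<forall>\<^sub>F y in nhds x. k *\<^sub>R (y - x) \<in> interior V"
      using topological_tendstoD[OF tendsto_scaleR_diff_0] assms(2) by blast
    then show "\<forall>\<^sub>F y in nhds x. dist (g y) (g x) < e"
    proof eventually_elim
      case (elim y)
      then have "\<bar>g (k *\<^sub>R (y - x))\<bar> \<le> c"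
        using bound interior_subset by blast
      moreover have "g (k *\<^sub>R (y - x)) = k * (g y - g x)"
        by (simp add: linear_scale[OF assms(1)] linear_diff[OF assms(1)])
      ultimately have "k * \<bar>g y - g x\<bar> \<le> c"
        using \<open>0 < k\<close> by (simp add: abs_mult)
      then have "k * \<bar>g y - g x\<bar> < k * e"
        using \<open>c < k * e\<close> by (rule le_less_trans)
      then show ?case
        using \<open>0 < k\<close> by (simp add: dist_real_def)
    qed
  qed
  then show ?thesis
    by (auto simp: continuous_on_def intro: tendsto_mono[OF at_within_le_nhds])
qed

lemma ex_symmetric_convex_neighbourhood:
  fixes U :: "'a::lctv_space set"
  assumes "0 \<in> interior U"
  obtains V where "convex V" "0 \<in> interior V" "V \<subseteq> U" "\<And>v. v \<in> V \<Longrightarrow> - v \<in> V"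
proof -
  obtain C where C: "convex C" "0 \<in> interior C" "C \<subseteq> interior U"
    using lctv_convex_nhds_0[OF open_interior assms] by blast
  let ?V = "C \<inter> uminus ` C"
  have "open (uminus -` interior C)"
    by (intro open_vimage open_interior continuous_on_minus continuous_on_id)
  moreover have "interior C \<inter> uminus -` interior C \<subseteq> ?V"
  proof
    fix x assume "x \<in> interior C \<inter> uminus -` interior C"
    then have "x \<in> C" "- x \<in> C"
      using interior_subset by auto
    then show "x \<in> ?V"
      by (auto intro: image_eqI[of x uminus "- x"])
  qed
  ultimately have "0 \<in> interior ?V"
    using C(2) by (intro interiorI[of "interior C \<inter> uminus -` interior C"]) auto
  moreover have "convex ?V"
    using C(1) by (intro convex_Int convex_negations)
  moreover have "?V \<subseteq> U"
    using C(3) interior_subset by blast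
  moreover have "- v \<in> ?V" if "v \<in> ?V" for v
    using that by auto
  ultimately show ?thesis
    using that by blast
qed

section \<open>Affine minorants of convex sets\<close>

lemma mem_convex_cone_hull_convex:
  assumes "p \<in> convex_cone hull S" "convex S" "S \<noteq> {}"
  obtains r x where "0 \<le> r" "x \<in> S" "p = r *\<^sub>R x"
proof -
  have "convex_cone hull S = conic hull S"
    using convex_cone_hull_separate_nonempty[OF assms(3)] assms(2) by (simp add: hull_same)
  then show ?thesis
    using assms(1) that unfolding conic_hull_explicit by blast
qed

text \<open>
  The cone over \<open>E - (0, \<beta>)\<close> and \<open>V \<times> {c}\<close> with \<open>c = m - \<beta>\<close> does not reach below the origin:
  otherwise \<open>z = - (a *\<^sub>R v)\<close> for some \<open>(z, l) \<in> E\<close>, \<open>v \<in> V\<close> and \<open>l - \<beta> + a * c < 0\<close>.  For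
  \<open>a \<le> 1\<close> the point \<open>z\<close> lies in \<open>V\<close>, where \<open>l \<ge> \<beta>\<close>.  For \<open>a > 1\<close> the segment from \<open>(0, m)\<close> to
  \<open>(z, l)\<close> passes above \<open>- v \<in> V\<close>, so it has height at least \<open>\<beta>\<close> there; extrapolating from this
  gives \<open>l - \<beta> \<ge> - (a - 1) * c\<close>.
\<close>

lemma continuous_affine_minorant:
  fixes E :: "('a::lctv_space \<times> real) set"
  assumes "convex E" and origin: "(0, m) \<in> E" and nhd: "0 \<in> interior U"
    and ge: "\<And>z l. \<lbrakk>(z, l) \<in> E; z \<in> U\<rbrakk> \<Longrightarrow> \<beta> \<le> l"
  obtains g where "g \<in> topological_dual" "\<And>z l. (z, l) \<in> E \<Longrightarrow> g z + \<beta> \<le> l"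
proof -
  obtain V where "convex V" "0 \<in> interior V" "V \<subseteq> U" and sym: "\<And>v. v \<in> V \<Longrightarrow> - v \<in> V"
    using ex_symmetric_convex_neighbourhood[OF nhd] by blast
  have "0 \<in> V"
    using \<open>0 \<in> interior V\<close> interior_subset by blast
  define c where "c = m - \<beta>"
  have "0 \<le> c"
    using ge[OF origin] \<open>0 \<in> V\<close> \<open>V \<subseteq> U\<close> by (auto simp: c_def)
  define A where "A = (\<lambda>p. p - (0, \<beta>)) ` E"
  have "convex A"
    unfolding A_def by (intro convex_translation_subtract \<open>convex E\<close>)
  have "convex (V \<times> {c})"
    by (intro convex_Times \<open>convex V\<close> convex_singleton)
  define K where "K = convex_cone hull (A \<union> V \<times> {c})"
  have "convex_cone K"
    unfolding K_def by (rule convex_cone_convex_cone_hull)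
  have A_K: "(z, l - \<beta>) \<in> K" if "(z, l) \<in> E" for z l
    unfolding K_def A_def using that by (intro hull_inc UnI1 image_eqI[of _ _ "(z, l)"]) auto
  have V_K: "(v, c) \<in> K" if "v \<in> V" for v
    unfolding K_def using that by (intro hull_inc) auto

  have key: "0 \<le> l - \<beta> + a * c" if E: "(z, l) \<in> E" and v: "v \<in> V" and "0 \<le> a" and z: "z = - (a *\<^sub>R v)"
    for z l v a
  proof (cases "a \<le> 1")
    case True
    have "a *\<^sub>R (- v) + (1 - a) *\<^sub>R 0 \<in> V"
      using True \<open>0 \<le> a\<close> \<open>0 \<in> V\<close> sym[OF v] by (intro convexD[OF \<open>convex V\<close>]) auto
    then have "z \<in> V"
      by (simp add: z)
    then show ?thesis
      using ge[OF E] \<open>V \<subseteq> U\<close> \<open>0 \<le> a\<close> \<open>0 \<le> c\<close> by (auto intro: add_nonneg_nonneg)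
  next
    case False
    have "(1 / a) *\<^sub>R (z, l) + (1 - 1 / a) *\<^sub>R (0, m) \<in> E"
      using False by (intro convexD[OF \<open>convex E\<close> E origin]) auto
    then have "(- v, l / a + (1 - 1 / a) * m) \<in> E"
      using False by (simp add: z)
    then have "\<beta> \<le> l / a + (1 - 1 / a) * m"
      using ge sym[OF v] \<open>V \<subseteq> U\<close> by blast
    then have "a * \<beta> \<le> a * (l / a + (1 - 1 / a) * m)"
      using False by simp
    also have "\<dots> = l + (a - 1) * m"
      using False by (simp add: field_simps)
    finally have "c \<le> l - \<beta> + a * c"
      by (simp add: c_def algebra_simps)
    then show ?thesis
      using \<open>0 \<le> c\<close> by simp
  qed

  have "0 \<le> t" if K: "(0, t) \<in> K" for t
  proof -
    have "A \<noteq> {}" "V \<times> {c} \<noteq> {}"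
      using origin \<open>0 \<in> V\<close> by (auto simp: A_def)
    obtain p q where p: "p \<in> convex_cone hull A" and q: "q \<in> convex_cone hull (V \<times> {c})"
      and t: "(0, t) = p + q"
      using K unfolding K_def convex_cone_hull_Un by blast
    obtain s a where "0 \<le> s" "a \<in> A" "p = s *\<^sub>R a"
      using mem_convex_cone_hull_convex[OF p \<open>convex A\<close> \<open>A \<noteq> {}\<close>] .
    then obtain z l where E: "(z, l) \<in> E" and p: "p = s *\<^sub>R (z, l - \<beta>)"
      by (auto simp: A_def)
    obtain r w where "0 \<le> r" "w \<in> V \<times> {c}" "q = r *\<^sub>R w"
      using mem_convex_cone_hull_convex[OF q \<open>convex (V \<times> {c})\<close> \<open>V \<times> {c} \<noteq> {}\<close>] .
    then obtain v where v: "v \<in> V" and q: "q = r *\<^sub>R (v, c)"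
      by blast
    have sum: "s *\<^sub>R z + r *\<^sub>R v = 0" "t = s * (l - \<beta>) + r * c"
      using t p q by simp_all
    show "0 \<le> t"
    proof (cases "s = 0")
      case True
      then show ?thesis
        using sum(2) \<open>0 \<le> r\<close> \<open>0 \<le> c\<close> by simp
    next
      case False
      with \<open>0 \<le> s\<close> have "0 < s"
        by simp
      have "s *\<^sub>R z = - (r *\<^sub>R v)"
        using sum(1) by (simp add: eq_neg_iff_add_eq_0)
      then have "(1 / s) *\<^sub>R (s *\<^sub>R z) = (1 / s) *\<^sub>R (- (r *\<^sub>R v))"
        by simp
      then have "z = - ((r / s) *\<^sub>R v)"
        using \<open>0 < s\<close> by simp
      then have "0 \<le> s * (l - \<beta> + (r / s) * c)"
        using key[OF E v, of "r / s"] \<open>0 < s\<close> \<open>0 \<le> r\<close> by simp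
      also have "\<dots> = t"
        using \<open>0 < s\<close> by (simp add: sum(2) distrib_left)
      finally show ?thesis .
    qed
  qed
  moreover have "\<exists>t. (x, t) \<in> K" for x
  proof -
    obtain r where "0 < r" "r *\<^sub>R x \<in> V"
      using neighbourhood_of_0_absorbing[OF \<open>0 \<in> interior V\<close>] by blast
    then have "(1 / r) *\<^sub>R (r *\<^sub>R x, c) \<in> K"
      using V_K by (intro convex_cone_scaleR[OF \<open>convex_cone K\<close>]) auto
    then show ?thesis
      using \<open>0 < r\<close> by auto
  qed
  ultimately obtain g where "linear g" and g: "\<And>x t. (x, t) \<in> K \<Longrightarrow> g x \<le> t"
    using linear_functional_below_convex_cone[OF \<open>convex_cone K\<close>] by blast
  have "\<bar>g v\<bar> \<le> c" if "v \<in> V" for v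
    using g[OF V_K[OF that]] g[OF V_K[OF sym[OF that]]] linear_neg[OF \<open>linear g\<close>, of v] by simp
  then have "continuous_on UNIV g"
    by (rule continuous_on_linear_if_bounded_on_neighbourhood[OF \<open>linear g\<close> \<open>0 \<in> interior V\<close>])
  then have "g \<in> topological_dual"
    using \<open>linear g\<close> by (simp add: topological_dual_def)
  moreover have "g z + \<beta> \<le> l" if "(z, l) \<in> E" for z l
    using g[OF A_K[OF that]] by simp
  ultimately show ?thesis
    using that by blast
qed

section \<open>The marginal function\<close>

text \<open>
  This set lies between the strict epigraph and the epigraph of the marginal function, so it has the
  same affine minorants as that function.  Its convexity requires no approximation of the infimum,
  because it is a projection of the convex set \<open>{((x, y), l). ((x, y), l) \<in> epi \<phi> \<and> (x, y) \<in> graph F}\<close>.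
\<close>

lemma convex_marginal_epigraph:
  assumes "convex_fun \<phi>" "convex_map F"
  shows "convex {(x, l). \<exists>y\<in>F x. \<phi> (x, y) \<le> ereal l}"
proof (rule convexI, clarsimp)
  fix x l y x' l' y' and u v :: real
  assume F: "y \<in> F x" "y' \<in> F x'" and \<phi>: "\<phi> (x, y) \<le> ereal l" "\<phi> (x', y') \<le> ereal l'"
    and uv: "0 \<le> u" "0 \<le> v" "u + v = 1"
  have "u *\<^sub>R ((x, y), l) + v *\<^sub>R ((x', y'), l') \<in> epi \<phi>"
    using assms(1) \<phi> uv unfolding convex_fun_def by (intro convexD) (auto simp: epi_def)
  moreover have "u *\<^sub>R (x, y) + v *\<^sub>R (x', y') \<in> graph F"
    using assms(2) F uv unfolding convex_map_def by (intro convexD) (auto simp: graph_def)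
  ultimately show "\<exists>w\<in>F (u *\<^sub>R x + v *\<^sub>R x'). \<phi> (u *\<^sub>R x + v *\<^sub>R x', w) \<le> ereal (u * l + v * l')"
    by (auto simp: epi_def graph_def)
qed

text \<open>
  A tube argument: the open set in which upper semicontinuity has to trap the values of \<open>F\<close> is the
  union of the second sides of finitely many boxes on which \<open>\<phi> > \<beta>\<close>, and the neighbourhood of \<open>x0\<close>
  has to lie in the intersection of their first sides.
\<close>

lemma marginal_ge_on_neighbourhood:
  fixes \<phi> :: "'a::topological_space \<times> 'b::topological_space \<Rightarrow> ereal"
  assumes "compact (F x0)" "usc_map_at F x0" and lsc: "\<And>y. y \<in> F x0 \<Longrightarrow> lsc_at \<phi> (x0, y)"
    and less: "ereal \<beta> < marginal \<phi> F x0"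
  obtains U where "x0 \<in> interior U" "\<And>x. x \<in> U \<Longrightarrow> ereal \<beta> \<le> marginal \<phi> F x"
proof -
  have "\<exists>A B. open A \<and> open B \<and> x0 \<in> A \<and> y \<in> B \<and> (\<forall>x\<in>A. \<forall>b\<in>B. ereal \<beta> < \<phi> (x, b))"
    if y: "y \<in> F x0" for y
  proof -
    have "ereal \<beta> < \<phi> (x0, y)"
      using less y unfolding marginal_def by (meson INF_lower less_le_trans)
    then obtain W where W: "(x0, y) \<in> interior W" "\<forall>p\<in>W. ereal \<beta> < \<phi> p"
      using lsc[OF y] unfolding lsc_at_def by blast
    obtain A B where "open A" "open B" "(x0, y) \<in> A \<times> B" "A \<times> B \<subseteq> interior W"
      using open_prod_elim[OF open_interior W(1)] by blast
    then show ?thesis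
      using W(2) interior_subset[of W] by blast
  qed
  then obtain A B where AB: "\<And>y. y \<in> F x0 \<Longrightarrow> open (A y) \<and> open (B y) \<and> x0 \<in> A y \<and> y \<in> B y
      \<and> (\<forall>x\<in>A y. \<forall>b\<in>B y. ereal \<beta> < \<phi> (x, b))"
    by metis
  have "F x0 \<subseteq> (\<Union>y\<in>F x0. B y)"
    using AB by blast
  then obtain Y where Y: "Y \<subseteq> F x0" "finite Y" "F x0 \<subseteq> (\<Union>y\<in>Y. B y)"
    using compactE_image[OF assms(1)] AB by metis
  moreover have "open (\<Union>y\<in>Y. B y)"
    using AB Y(1) by blast
  ultimately obtain U where U: "x0 \<in> interior U" "\<forall>x\<in>U. F x \<subseteq> (\<Union>y\<in>Y. B y)"
    using assms(2) unfolding usc_map_at_def by meson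
  let ?U = "interior U \<inter> (\<Inter>y\<in>Y. A y)"
  have "open ?U"
    using AB Y(1,2) by (intro open_Int open_INT open_interior) auto
  moreover have "x0 \<in> ?U"
    using U(1) AB Y(1) by auto
  ultimately have "x0 \<in> interior ?U"
    by (simp only: interior_open)
  moreover have "ereal \<beta> \<le> marginal \<phi> F x" if "x \<in> ?U" for x
    unfolding marginal_def
  proof (rule INF_greatest)
    fix b assume "b \<in> F x"
    moreover have "x \<in> U"
      using that interior_subset by blast
    ultimately obtain y where "y \<in> Y" "b \<in> B y"
      using U(2) by blast
    then have "ereal \<beta> < \<phi> (x, b)"
      using AB Y(1) that by blast
    then show "ereal \<beta> \<le> \<phi> (x, b)"
      by simp
  qed
  ultimately show ?thesis
    using that by blast
qed

section \<open>Duality\<close>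

lemma fenchel_conjugate_weak_duality:
  assumes "xs \<in> topological_dual"
  shows "- fenchel_conjugate f xs \<le> f 0"
proof -
  have "xs 0 = 0"
    using assms by (simp add: topological_dual_def linear_0)
  then have "- f 0 = ereal (xs 0) - f 0"
    by (simp add: zero_ereal_def[symmetric])
  also have "\<dots> \<le> fenchel_conjugate f xs"
    unfolding fenchel_conjugate_def by (rule SUP_upper) simp
  finally show ?thesis
    by (simp add: ereal_uminus_le_reorder)
qed

lemma fenchel_conjugate_affine_minorant:
  assumes "\<And>x. ereal (xs x + \<beta>) \<le> f x"
  shows "ereal \<beta> \<le> - fenchel_conjugate f xs"
proof -
  have "ereal (xs x) - f x \<le> ereal (- \<beta>)" for x
    using assms[of x] by (cases "f x") auto
  then have "fenchel_conjugate f xs \<le> ereal (- \<beta>)"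
    unfolding fenchel_conjugate_def by (intro SUP_least)
  then show ?thesis
    by (cases "fenchel_conjugate f xs") auto
qed

theorem proposition7p6:
  fixes \<phi> :: "'a::lctv_space \<times> 'b::lctv_space \<Rightarrow> ereal"
    and F :: "'a \<Rightarrow> 'b set"
  assumes "marginal \<phi> F 0 \<in> range ereal"
    and "compact (F 0)"
    and "convex_map F"
    and "usc_map_at F 0"
    and "convex_fun \<phi>"
    and "\<And>y. y \<in> F 0 \<Longrightarrow> lsc_at \<phi> (0, y)"
  shows "(SUP xs\<in>topological_dual. - fenchel_conjugate (marginal \<phi> F) xs)
           = (INF y\<in>F 0. \<phi> (0, y))
         \<and> (INF y\<in>F 0. \<phi> (0, y)) \<in> range ereal"
proof -
  let ?\<mu> = "marginal \<phi> F"
  let ?dual = "SUP xs\<in>topological_dual. - fenchel_conjugate ?\<mu> xs"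
  let ?E = "{(x, l). \<exists>y\<in>F x. \<phi> (x, y) \<le> ereal l}"
  obtain m where m: "?\<mu> 0 = ereal m"
    using assms(1) by blast
  have above: "?\<mu> z \<le> ereal l" if "(z, l) \<in> ?E" for z l
    using that unfolding marginal_def by (auto intro: INF_lower2)
  have "ereal \<beta> \<le> ?dual" if less: "ereal \<beta> < ?\<mu> 0" for \<beta>
  proof -
    obtain U where U: "0 \<in> interior U" "\<And>x. x \<in> U \<Longrightarrow> ereal \<beta> \<le> ?\<mu> x"
      using marginal_ge_on_neighbourhood[OF assms(2,4,6) less] by blast
    have "?\<mu> 0 < ereal (m + 1)"
      by (simp add: m)
    then have origin: "(0, m + 1) \<in> ?E"
      unfolding marginal_def INF_less_iff by (auto intro: less_imp_le)
    have "\<beta> \<le> l" if "(z, l) \<in> ?E" "z \<in> U" for z l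
      using order_trans[OF U(2)[OF that(2)] above[OF that(1)]] by simp
    then obtain g where "g \<in> topological_dual" and g: "\<And>z l. (z, l) \<in> ?E \<Longrightarrow> g z + \<beta> \<le> l"
      using continuous_affine_minorant[OF convex_marginal_epigraph[OF assms(5,3)] origin U(1)]
      by blast
    have "ereal (g x + \<beta>) \<le> ?\<mu> x" for x
      unfolding marginal_def
    proof (rule INF_greatest)
      fix y assume "y \<in> F x"
      (* Testing against real upper bounds also covers the value minus infinity. *)
      show "ereal (g x + \<beta>) \<le> \<phi> (x, y)"
      proof (rule ereal_le_real)
        fix l assume "\<phi> (x, y) \<le> ereal l"
        with \<open>y \<in> F x\<close> show "ereal (g x + \<beta>) \<le> ereal l"
          using g by auto
      qed
    qed
    then have "ereal \<beta> \<le> - fenchel_conjugate ?\<mu> g"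
      by (rule fenchel_conjugate_affine_minorant)
    also have "\<dots> \<le> ?dual"
      using \<open>g \<in> topological_dual\<close> by (rule SUP_upper)
    finally show ?thesis .
  qed
  then have "b \<le> ?dual" if "b < ?\<mu> 0" for b
    using that m by (cases b) auto
  then have "?\<mu> 0 \<le> ?dual"
    by (rule dense_le)
  moreover have "?dual \<le> ?\<mu> 0"
    by (intro SUP_least fenchel_conjugate_weak_duality)
  ultimately have "?dual = ?\<mu> 0"
    by (rule antisym[rotated])
  then show ?thesis
    using assms(1) by (simp add: marginal_def[of \<phi> F 0])
qed

end
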